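(* Let $h,m\geq 0$ and $i\geq 1$ be integers and let $\mathbf p\in\bigwedge M_n$. Then $$D_h^{m}(\epsilon^i\wedge\mathbf p)=\sum_{j=0}^{m}\binom{m}{j}\,D_{h-1}^{\,j}\bigl(\epsilon^{i+j}\wedge D_h^{\,m-j}\mathbf p\bigr).$$
   Context: $n$ is a fixed positive integer. $M_n:=X\mathbb Z[X]/(X^{n+1})$ and $\epsilon^i:=X^i+(X^{n+1})$ for $i\ge 1$, so $M_n$ is a free $\mathbb Z$-module with basis $\epsilon^1,\dots,\epsilon^n$ and $\epsilon^m=0$ for $m>n$. $\bigwedge M_n$ is the exterior algebra of $M_n$ over $\mathbb Z$. $D=(D_0,D_1,D_2,\dots)$ is the unique sequence of $\mathbb Z$-module endomorphisms of $\bigwedge M_n$ such that, for all $\mathbf p,\mathbf q\in\bigwedge M_n$, all $h,l\ge 0$ and all $i\ge 1$, $$D_h(\mathbf p\wedge\mathbf q)=\sum_{h_1+h_2=h,\ h_1,h_2\ge 0}D_{h_1}\mathbf p\wedge D_{h_2}\mathbf q,\qquad D_l\,\epsilon^i=\epsilon^{i+l}.$$ In particular $D_0$ is the identity; the $D_h$ commute pairwise. Powers of $D_h$ denote iterated composition, with zeroth power the identity. Convention: $D_{-1}:=0$. *)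

theory Defs
  imports "HOL-Computational_Algebra.Polynomial" "HOL-Library.Poly_Mapping" "HOL-Library.Cardinality"
begin

section \<open>Quotients of noncommutative rings\<close>

inductive_set two_sided_ideal :: "'a::ring_1 set \<Rightarrow> 'a set" for G where
  zero: "0 \<in> two_sided_ideal G"
| gen: "g \<in> G \<Longrightarrow> a * g * b \<in> two_sided_ideal G"
| add: "x \<in> two_sided_ideal G \<Longrightarrow> y \<in> two_sided_ideal G \<Longrightarrow> x + y \<in> two_sided_ideal G"

lemma two_sided_ideal_mult_left:
  "x \<in> two_sided_ideal G \<Longrightarrow> c * x \<in> two_sided_ideal G"
proof (induction rule: two_sided_ideal.induct)
  case (gen g a b)
  then show ?case
    using two_sided_ideal.gen[of g G "c * a" b] by (simp add: mult.assoc)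
qed (auto simp: distrib_left intro: two_sided_ideal.intros)

lemma two_sided_ideal_mult_right:
  "x \<in> two_sided_ideal G \<Longrightarrow> x * c \<in> two_sided_ideal G"
proof (induction rule: two_sided_ideal.induct)
  case (gen g a b)
  then show ?case
    using two_sided_ideal.gen[of g G a "b * c"] by (simp add: mult.assoc)
qed (auto simp: distrib_right intro: two_sided_ideal.intros)

lemma two_sided_ideal_uminus:
  "x \<in> two_sided_ideal G \<Longrightarrow> - x \<in> two_sided_ideal G"
  using two_sided_ideal_mult_left[of x G "- 1"] by simp

definition ideal_cong :: "'a::ring_1 set \<Rightarrow> 'a \<Rightarrow> 'a \<Rightarrow> bool" where
  "ideal_cong G x y \<longleftrightarrow> x - y \<in> two_sided_ideal G"

lemma equivp_ideal_cong: "equivp (ideal_cong G)"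
proof (rule equivpI)
  show "reflp (ideal_cong G)"
    by (auto simp: reflp_def ideal_cong_def intro: two_sided_ideal.zero)
  show "symp (ideal_cong G)"
    using two_sided_ideal_uminus by (fastforce simp: symp_def ideal_cong_def)
  show "transp (ideal_cong G)"
    unfolding transp_def ideal_cong_def
    by (metis diff_add_cancel add_diff_eq two_sided_ideal.add)
qed

lemma ideal_cong_refl: "ideal_cong G x x"
  by (simp add: ideal_cong_def two_sided_ideal.zero)

lemma ideal_cong_add:
  "ideal_cong G x x' \<Longrightarrow> ideal_cong G y y' \<Longrightarrow> ideal_cong G (x + y) (x' + y')"
  unfolding ideal_cong_def by (metis add_diff_add two_sided_ideal.add)

lemma ideal_cong_uminus: "ideal_cong G x x' \<Longrightarrow> ideal_cong G (- x) (- x')"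
  unfolding ideal_cong_def
  by (metis minus_diff_minus two_sided_ideal_uminus)

lemma ideal_cong_diff:
  "ideal_cong G x x' \<Longrightarrow> ideal_cong G y y' \<Longrightarrow> ideal_cong G (x - y) (x' - y')"
  using ideal_cong_add[of G x x' "- y" "- y'"] ideal_cong_uminus[of G y y'] by simp

lemma ideal_cong_mult:
  assumes "ideal_cong G x x'" "ideal_cong G y y'"
  shows "ideal_cong G (x * y) (x' * y')"
proof -
  have "x * y - x' * y' = (x - x') * y + x' * (y - y')"
    by (simp add: algebra_simps)
  then show ?thesis
    using assms two_sided_ideal_mult_left two_sided_ideal_mult_right two_sided_ideal.add
    unfolding ideal_cong_def by metis
qed


section \<open>The tensor algebra of an abelian group over the integers\<close>

datatype 'a word = Word "'a list"

instantiation word :: (type) monoid_add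
begin

definition "0 = Word []"

fun plus_word :: "'a word \<Rightarrow> 'a word \<Rightarrow> 'a word" where
  "Word u + Word v = Word (u @ v)"

instance
proof
  fix a b c :: "'a word"
  show "a + b + c = a + (b + c)" by (cases a; cases b; cases c) simp
  show "0 + a = a" by (cases a) (simp add: zero_word_def)
  show "a + 0 = a" by (cases a) (simp add: zero_word_def)
qed

end

text \<open>
  \<^typ>\<open>'a word \<Rightarrow>\<^sub>0 int\<close> is the free associative unital ring on the set of all
  elements of \<^typ>\<open>'a\<close>. Its quotient by the relations saying that the inclusion of generators
  is additive (equivalently, linear over the integers) is the tensor algebra of \<^typ>\<open>'a\<close>.
\<close>

definition free_gen :: "'a \<Rightarrow> 'a word \<Rightarrow>\<^sub>0 int" where
  "free_gen a = Poly_Mapping.single (Word [a]) 1"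

definition tensor_relators :: "('a::ab_group_add word \<Rightarrow>\<^sub>0 int) set" where
  "tensor_relators = {free_gen (a + b) - free_gen a - free_gen b | a b. True}"

quotient_type (overloaded) 'a tensor_algebra =
  "'a::ab_group_add word \<Rightarrow>\<^sub>0 int" / "ideal_cong tensor_relators"
  by (rule equivp_ideal_cong)

lemma word_add_eq_0_iff: "(0::'a word) = u + v \<longleftrightarrow> u = 0 \<and> v = 0"
  by (cases u; cases v) (auto simp: zero_word_def)

lemma lookup_mult_zero_word:
  fixes p q :: "'a word \<Rightarrow>\<^sub>0 int"
  shows "Poly_Mapping.lookup (p * q) 0 = Poly_Mapping.lookup p 0 * Poly_Mapping.lookup q 0"
proof -
  have "Poly_Mapping.lookup (p * q) 0 =
      (\<Sum>l. Poly_Mapping.lookup p l * (\<Sum>r. Poly_Mapping.lookup q r when ((0::'a word) = l + r)))"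
    by (simp add: lookup_mult)
  also have "\<dots> = (\<Sum>l. Poly_Mapping.lookup p l * Poly_Mapping.lookup q 0 when (l = 0))"
  proof (rule Sum_any.cong)
    fix l :: "'a word"
    have "(\<Sum>r. Poly_Mapping.lookup q r when ((0::'a word) = l + r)) = (Poly_Mapping.lookup q 0 when (l = 0))"
      by (cases "l = 0") (simp_all add: word_add_eq_0_iff)
    then show "Poly_Mapping.lookup p l * (\<Sum>r. Poly_Mapping.lookup q r when ((0::'a word) = l + r))
        = (Poly_Mapping.lookup p l * Poly_Mapping.lookup q 0 when (l = 0))"
      by (simp add: mult_when)
  qed
  finally show ?thesis by simp
qed

lemma lookup_free_gen_zero: "Poly_Mapping.lookup (free_gen a) 0 = 0"
  by (simp add: free_gen_def zero_word_def lookup_single)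

lemma lookup_tensor_ideal:
  assumes "x \<in> two_sided_ideal tensor_relators"
  shows "Poly_Mapping.lookup x 0 = 0"
  using assms
  by induction
    (auto simp: lookup_mult_zero_word tensor_relators_def lookup_free_gen_zero lookup_minus lookup_add)

instantiation tensor_algebra :: (ab_group_add) ring_1
begin

lift_definition zero_tensor_algebra :: "'a tensor_algebra" is 0 .
lift_definition one_tensor_algebra :: "'a tensor_algebra" is 1 .
lift_definition plus_tensor_algebra ::
  "'a tensor_algebra \<Rightarrow> 'a tensor_algebra \<Rightarrow> 'a tensor_algebra" is "(+)"
  by (rule ideal_cong_add)
lift_definition minus_tensor_algebra ::
  "'a tensor_algebra \<Rightarrow> 'a tensor_algebra \<Rightarrow> 'a tensor_algebra" is "(-)"
  by (rule ideal_cong_diff)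
lift_definition uminus_tensor_algebra ::
  "'a tensor_algebra \<Rightarrow> 'a tensor_algebra" is uminus
  by (rule ideal_cong_uminus)
lift_definition times_tensor_algebra ::
  "'a tensor_algebra \<Rightarrow> 'a tensor_algebra \<Rightarrow> 'a tensor_algebra" is "(*)"
  by (rule ideal_cong_mult)

instance
proof
  show "(0::'a tensor_algebra) \<noteq> 1"
    by transfer (auto simp: ideal_cong_def lookup_minus lookup_one dest: lookup_tensor_ideal)
qed (transfer; simp add: algebra_simps ideal_cong_refl)+

end

lift_definition tensor_incl :: "'a::ab_group_add \<Rightarrow> 'a tensor_algebra" is free_gen .


section \<open>The exterior algebra of an abelian group over the integers\<close>

definition exterior_relators :: "'a::ab_group_add tensor_algebra set" where
  "exterior_relators = {tensor_incl a * tensor_incl a | a. True}"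

quotient_type (overloaded) 'a exterior =
  "'a::ab_group_add tensor_algebra" / "ideal_cong exterior_relators"
  by (rule equivp_ideal_cong)

lift_definition tensor_aug :: "'a::ab_group_add tensor_algebra \<Rightarrow> int" is "\<lambda>p. Poly_Mapping.lookup p 0"
  by (auto simp: ideal_cong_def lookup_minus dest: lookup_tensor_ideal)

lemma tensor_aug_simps:
  "tensor_aug 0 = 0" "tensor_aug 1 = 1"
  "tensor_aug (x + y) = tensor_aug x + tensor_aug y"
  "tensor_aug (x - y) = tensor_aug x - tensor_aug y"
  "tensor_aug (x * y) = tensor_aug x * tensor_aug y"
  "tensor_aug (tensor_incl a) = 0"
  by (transfer; simp add: lookup_add lookup_minus lookup_mult_zero_word lookup_free_gen_zero
      lookup_one)+

lemma tensor_aug_exterior_ideal: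
  assumes "x \<in> two_sided_ideal exterior_relators"
  shows "tensor_aug x = 0"
  using assms by induction (auto simp: tensor_aug_simps exterior_relators_def)

text \<open>The multiplication \<^term>\<open>(*)\<close> of \<^typ>\<open>'a exterior\<close> is the wedge product.\<close>

instantiation exterior :: (ab_group_add) ring_1
begin

lift_definition zero_exterior :: "'a exterior" is 0 .
lift_definition one_exterior :: "'a exterior" is 1 .
lift_definition plus_exterior :: "'a exterior \<Rightarrow> 'a exterior \<Rightarrow> 'a exterior" is "(+)"
  by (rule ideal_cong_add)
lift_definition minus_exterior :: "'a exterior \<Rightarrow> 'a exterior \<Rightarrow> 'a exterior" is "(-)"
  by (rule ideal_cong_diff)
lift_definition uminus_exterior :: "'a exterior \<Rightarrow> 'a exterior" is uminus
  by (rule ideal_cong_uminus)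
lift_definition times_exterior :: "'a exterior \<Rightarrow> 'a exterior \<Rightarrow> 'a exterior" is "(*)"
  by (rule ideal_cong_mult)

instance
proof
  show "(0::'a exterior) \<noteq> 1"
    by transfer
      (use tensor_aug_exterior_ideal[of "0 - 1"] in \<open>auto simp: ideal_cong_def tensor_aug_simps(1,2,4)
        simp del: diff_0\<close>)
qed (transfer; simp add: algebra_simps ideal_cong_refl)+

end

lift_definition exterior_incl :: "'a::ab_group_add \<Rightarrow> 'a exterior" is tensor_incl .


section \<open>The truncated polynomial module\<close>

text \<open>
  \<open>'n trunc\<close> is $X\mathbb{Z}[X]/(X^{n+1})$ with $n$ = \<open>CARD('n)\<close>: the relation is partial, its
  domain being the polynomials divisible by $X$.
\<close>

definition trunc_rel :: "nat \<Rightarrow> int poly \<Rightarrow> int poly \<Rightarrow> bool" where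
  "trunc_rel n p q \<longleftrightarrow>
     monom 1 1 dvd p \<and> monom 1 1 dvd q \<and> monom 1 (n + 1) dvd p - q"

lemma part_equivp_trunc_rel: "part_equivp (trunc_rel n)"
proof (rule part_equivpI)
  show "\<exists>x. trunc_rel n x x"
    by (rule exI[of _ 0]) (simp add: trunc_rel_def)
  show "symp (trunc_rel n)"
    unfolding symp_def trunc_rel_def
  proof (intro allI impI, elim conjE, intro conjI)
    fix p q :: "int poly"
    assume "monom 1 (n + 1) dvd p - q"
    then have "monom 1 (n + 1) dvd - (p - q)" by (simp only: dvd_minus_iff)
    then show "monom 1 (n + 1) dvd q - p" by simp
  qed
  show "transp (trunc_rel n)"
    unfolding transp_def trunc_rel_def
  proof (intro allI impI, elim conjE, intro conjI)
    fix p q r :: "int poly"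
    assume "monom 1 (n + 1) dvd p - q" "monom 1 (n + 1) dvd q - r"
    then show "monom 1 (n + 1) dvd p - r"
      using dvd_add[of "monom 1 (n + 1)" "p - q" "q - r"] by simp
  qed
qed

typedef 'n trunc =
  "{C. \<exists>p. trunc_rel CARD('n::finite) p p \<and> C = Collect (trunc_rel CARD('n) p)}"
  by (rule exI[of _ "Collect (trunc_rel CARD('n) 0)"]) (auto simp: trunc_rel_def)

lemma quot_type_trunc:
  "quot_type (trunc_rel CARD('n::finite)) (Abs_trunc :: _ \<Rightarrow> 'n trunc) Rep_trunc"
proof
  show "part_equivp (trunc_rel CARD('n))" by (rule part_equivp_trunc_rel)
  show "\<exists>x. trunc_rel CARD('n) x x \<and> Rep_trunc y = Collect (trunc_rel CARD('n) x)"
    for y :: "'n trunc"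
    using Rep_trunc[of y] by blast
  show "Abs_trunc (Rep_trunc x) = x" for x :: "'n trunc" by (rule Rep_trunc_inverse)
  show "Rep_trunc (Abs_trunc c :: 'n trunc) = c"
    if "\<exists>x. trunc_rel CARD('n) x x \<and> c = Collect (trunc_rel CARD('n) x)" for c
    using that by (intro Abs_trunc_inverse) blast
  show "Rep_trunc x = Rep_trunc y \<longleftrightarrow> x = y" for x y :: "'n trunc" by (rule Rep_trunc_inject)
qed

definition abs_trunc :: "int poly \<Rightarrow> 'n::finite trunc" where
  "abs_trunc = quot_type.abs (trunc_rel CARD('n)) Abs_trunc"

definition rep_trunc :: "'n::finite trunc \<Rightarrow> int poly" where
  "rep_trunc = quot_type.rep Rep_trunc"

definition cr_trunc :: "int poly \<Rightarrow> 'n::finite trunc \<Rightarrow> bool" where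
  "cr_trunc = (\<lambda>p x. trunc_rel CARD('n) p p \<and> abs_trunc p = x)"

lemma Quotient_trunc:
  "Quotient (trunc_rel CARD('n)) abs_trunc rep_trunc (cr_trunc :: _ \<Rightarrow> 'n::finite trunc \<Rightarrow> bool)"
  unfolding cr_trunc_def abs_trunc_def rep_trunc_def
  by (rule Quotient3_to_Quotient[OF quot_type.Quotient[OF quot_type_trunc]]) simp

setup_lifting Quotient_trunc

instantiation trunc :: (finite) ab_group_add
begin

lift_definition zero_trunc :: "'a trunc" is 0
  by (simp add: trunc_rel_def)
lift_definition plus_trunc :: "'a trunc \<Rightarrow> 'a trunc \<Rightarrow> 'a trunc" is "(+)"
  unfolding trunc_rel_def by (elim conjE, intro conjI) (simp_all only: add_diff_add dvd_add)
lift_definition minus_trunc :: "'a trunc \<Rightarrow> 'a trunc \<Rightarrow> 'a trunc" is "(-)"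
proof -
  fix p p' q q' :: "int poly"
  assume "trunc_rel CARD('a) p p'" "trunc_rel CARD('a) q q'"
  moreover have "(p - q) - (p' - q') = (p - p') - (q - q')" by simp
  ultimately show "trunc_rel CARD('a) (p - q) (p' - q')"
    unfolding trunc_rel_def by (elim conjE, intro conjI) (simp_all only: dvd_diff)
qed
lift_definition uminus_trunc :: "'a trunc \<Rightarrow> 'a trunc" is uminus
  unfolding trunc_rel_def
  by (elim conjE, intro conjI) (simp_all only: minus_diff_minus dvd_minus_iff)

instance
  by standard (transfer; simp add: algebra_simps trunc_rel_def)+

end

text \<open>The class of $X^i$, for $i \ge 1$; the value at $i = 0$ is a dummy, since $X^0$ is not
  divisible by $X$.\<close>

lift_definition eps_trunc :: "nat \<Rightarrow> 'n::finite trunc" is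
  "\<lambda>i. if i = 0 then 0 else monom 1 i"
  by (simp add: trunc_rel_def monom_1_dvd_iff')

definition eps :: "nat \<Rightarrow> 'n::finite trunc exterior" where
  "eps i = exterior_incl (eps_trunc i)"


section \<open>The sequence of endomorphisms\<close>

text \<open>The conditions determine the sequence uniquely. The action of the integers on
  \<^typ>\<open>'n::finite trunc exterior\<close> is \<open>of_int k * x\<close>.\<close>

definition schubert_derivation ::
  "(nat \<Rightarrow> 'n::finite trunc exterior \<Rightarrow> 'n trunc exterior) \<Rightarrow> bool" where
  "schubert_derivation D \<longleftrightarrow>
     (\<forall>h. module_hom (\<lambda>k x. of_int k * x) (\<lambda>k x. of_int k * x) (D h)) \<and>
     (\<forall>h p q. D h (p * q) = (\<Sum>h1\<le>h. D h1 p * D (h - h1) q)) \<and>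
     (\<forall>l. \<forall>i\<ge>1. D l (eps i) = eps (i + l))"

text \<open>Negative indices give the zero map.\<close>

definition int_seq :: "(nat \<Rightarrow> 'b \<Rightarrow> 'b::zero) \<Rightarrow> int \<Rightarrow> 'b \<Rightarrow> 'b" where
  "int_seq D k = (if k < 0 then (\<lambda>_. 0) else D (nat k))"

end

theory Submission
  imports Defs
begin

text \<open>
  Splitting off the first summand of the Leibniz rule gives
  $D_h(\epsilon^i \wedge q) = \epsilon^i \wedge D_h q + D_{h-1}(\epsilon^{i+1} \wedge q)$.
  As $D_h$ and $D_{h-1}$ commute, iterating this identity gives the binomial formula. The elements
  on which all $D_k$ commute pairwise include the generators and, by the Leibniz rule, are closed
  under products and differences.
\<close>

section \<open>Generation of the exterior algebra by the classes of powers of X\<close>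

lemma tensor_incl_add: "tensor_incl (a + b) = tensor_incl a + tensor_incl b"
proof transfer
  fix a b :: 'a
  have "1 * (free_gen (a + b) - free_gen a - free_gen b) * 1 \<in> two_sided_ideal tensor_relators"
    by (rule two_sided_ideal.gen) (auto simp: tensor_relators_def)
  then show "ideal_cong tensor_relators (free_gen (a + b)) (free_gen a + free_gen b)"
    by (simp add: ideal_cong_def diff_diff_eq)
qed

lemma exterior_incl_add: "exterior_incl (a + b) = exterior_incl a + exterior_incl b"
  by transfer (simp add: tensor_incl_add ideal_cong_refl)

lemma exterior_incl_diff: "exterior_incl (a - b) = exterior_incl a - exterior_incl b"
  using exterior_incl_add[of "a - b" b] by simp

text \<open>Differences supply 0, sums and negative coefficients, products of generators give all
  words, and a finitely supported function is built up one word at a time.\<close>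

lemma free_ring_induct [case_names one incl diff mult]:
  fixes x :: "'a word \<Rightarrow>\<^sub>0 int"
  assumes one: "P 1" and incl: "\<And>a. P (free_gen a)"
    and diff: "\<And>x y. P x \<Longrightarrow> P y \<Longrightarrow> P (x - y)"
    and mult: "\<And>x y. P x \<Longrightarrow> P y \<Longrightarrow> P (x * y)"
  shows "P x"
proof -
  have zero: "P 0" using diff[OF one one] by simp
  have add: "P (x + y)" if "P x" "P y" for x y
    using diff[OF that(1) diff[OF zero that(2)]] by simp
  have word: "P (Poly_Mapping.single (Word xs) 1)" for xs
  proof (induction xs)
    case Nil
    then show ?case using one by (simp flip: zero_word_def)
  next
    case (Cons a xs)
    have "Poly_Mapping.single (Word (a # xs)) (1::int)
        = free_gen a * Poly_Mapping.single (Word xs) 1"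
      by (simp add: free_gen_def mult_single)
    then show ?case using mult[OF incl Cons] by simp
  qed
  have single: "P (Poly_Mapping.single w k)" for w k
  proof (induction k rule: int_induct[where k = 0])
    case base
    then show ?case using zero by simp
  next
    case (step1 i)
    then show ?case using add word by (cases w) (simp add: single_add)
  next
    case (step2 i)
    then show ?case using diff word by (cases w) (simp add: single_diff)
  qed
  show ?thesis
  proof (induction x rule: update_induct)
    case const
    show ?case by (fact zero)
  next
    case (update f w k)
    \<comment> \<open>The word \<open>w\<close> is a fresh key of \<open>f\<close>, so overwriting
      its coefficient amounts to adding a single term.\<close>
    have "Poly_Mapping.update w k f = f + Poly_Mapping.single w k"
      using update(1)
      by (intro poly_mapping_eqI) (auto simp: lookup_update lookup_add lookup_single in_keys_iff)
    then show ?case using add[OF update(3) single] by simp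
  qed
qed

text \<open>Both quotient maps are surjective ring homomorphisms, so induction on the free ring
  descends.\<close>

lemma exterior_induct [case_names one incl diff mult]:
  fixes x :: "'a::ab_group_add exterior"
  assumes "P 1" and "\<And>a. P (exterior_incl a)"
    and "\<And>x y. P x \<Longrightarrow> P y \<Longrightarrow> P (x - y)"
    and "\<And>x y. P x \<Longrightarrow> P y \<Longrightarrow> P (x * y)"
  shows "P x"
proof -
  have "P (abs_exterior (abs_tensor_algebra f))" for f :: "'a word \<Rightarrow>\<^sub>0 int"
  proof (induction f rule: free_ring_induct)
    case one
    then show ?case
      using assms(1) by (simp add: one_exterior.abs_eq one_tensor_algebra.abs_eq)
  next
    case (incl a)
    then show ?case
      using assms(2)[of a] by (simp add: exterior_incl.abs_eq tensor_incl.abs_eq)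
  next
    case (diff x y)
    then show ?case
      using assms(3)[OF diff] by (simp add: minus_exterior.abs_eq minus_tensor_algebra.abs_eq)
  next
    case (mult x y)
    then show ?case
      using assms(4)[OF mult] by (simp add: times_exterior.abs_eq times_tensor_algebra.abs_eq)
  qed
  then show ?thesis
    by (induction x rule: exterior.abs_induct, rename_tac y)
      (induct_tac y rule: tensor_algebra.abs_induct)
qed

text \<open>A representative is a multiple of X, hence an integer combination of monomials X^(i+1).
  The quotient is partial, so \<open>cr_trunc\<close> carries a class along with each representative
  instead of applying \<open>abs_trunc\<close> to arbitrary polynomials.\<close>

lemma trunc_induct [case_names eps diff]:
  fixes x :: "'n::finite trunc"
  assumes eps: "\<And>i. i \<ge> 1 \<Longrightarrow> P (eps_trunc i)"
    and diff: "\<And>x y. P x \<Longrightarrow> P y \<Longrightarrow> P (x - y)"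
  shows "P x"
proof -
  let ?R = "cr_trunc :: _ \<Rightarrow> 'n trunc \<Rightarrow> bool"
  have zero: "P 0" using diff[OF eps eps, of 1 1] by simp
  have add: "P (x + y)" if "P x" "P y" for x y
    using diff[OF that(1) diff[OF zero that(2)]] by simp
  have cr_add: "?R (p + q) (x + y)" if "?R p x" "?R q y" for p q x y
    using plus_trunc.transfer that by (auto dest: rel_funD)
  have cr_diff: "?R (p - q) (x - y)" if "?R p x" "?R q y" for p q x y
    using minus_trunc.transfer that by (auto dest: rel_funD)
  have cr_zero: "?R 0 0"
    using zero_trunc.transfer by simp
  have cr_eps: "?R (monom 1 (Suc i)) (eps_trunc (Suc i))" for i
    using eps_trunc.transfer[unfolded rel_fun_def, rule_format, OF refl, of "Suc i"]
    by simp
  have monom: "\<exists>y. ?R (monom c (Suc i)) y \<and> P y" for c i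
  proof (induction c rule: int_induct[where k = 0])
    case base
    then show ?case using zero cr_zero by auto
  next
    case (step1 c)
    then show ?case
      using cr_add[OF _ cr_eps] add[OF _ eps] by (fastforce simp flip: add_monom)
  next
    case (step2 c)
    then show ?case
      using cr_diff[OF _ cr_eps] diff[OF _ eps] by (fastforce simp flip: diff_monom)
  qed
  have sum: "\<exists>y. ?R (\<Sum>i<k. monom (c i) (Suc i)) y \<and> P y" for c k
  proof (induction k)
    case 0
    then show ?case using zero cr_zero by auto
  next
    case (Suc k)
    then show ?case
      using monom[of "c k" k] cr_add add by (fastforce simp only: sum.lessThan_Suc)
  qed
  obtain p where p: "?R p x"
    using Quotient_cr_rel[OF Quotient_trunc] Quotient_rep_abs Quotient_trunc
    by (metis Quotient_abs_rep Quotient_rep_reflp)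
  then have "monom 1 1 dvd p"
    by (simp add: cr_trunc_def trunc_rel_def)
  then obtain q where q: "p = monom 1 1 * q" ..
  have "p = monom 1 1 * (\<Sum>i<Suc (degree q). monom (coeff q i) i)"
    by (simp only: q lessThan_Suc_atMost poly_as_sum_of_monoms)
  also have "\<dots> = (\<Sum>i<Suc (degree q). monom (coeff q i) (Suc i))"
    by (simp only: sum_distrib_left mult_monom mult_1 plus_1_eq_Suc)
  finally obtain y where "?R p y" "P y"
    using sum by metis
  with p show ?thesis by (auto simp: cr_trunc_def)
qed

section \<open>The Leibniz rule: commutation and the one-step identity\<close>

lemma schubert_derivation_add:
  "schubert_derivation D \<Longrightarrow> D h (x + y) = D h x + D h y"
  unfolding schubert_derivation_def by (blast intro: module_hom.add)

lemma schubert_derivation_diff: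
  assumes "schubert_derivation D"
  shows "D h (x - y) = D h x - D h y"
  using schubert_derivation_add[OF assms, of h "x - y" y] by simp

lemma schubert_derivation_sum:
  assumes "schubert_derivation D"
  shows "D h (sum f A) = (\<Sum>a\<in>A. D h (f a))"
  using sum_comp_morphism[of "D h" f A] schubert_derivation_add[OF assms, of h]
    schubert_derivation_diff[OF assms, of h 0 0]
  by (simp add: comp_def)

lemma schubert_derivation_mult:
  "schubert_derivation D \<Longrightarrow> D h (p * q) = (\<Sum>k\<le>h. D k p * D (h - k) q)"
  unfolding schubert_derivation_def by blast

lemma schubert_derivation_eps:
  "schubert_derivation D \<Longrightarrow> i \<ge> 1 \<Longrightarrow> D l (eps i) = eps (i + l)"
  unfolding schubert_derivation_def by blast

text \<open>Two applications of the Leibniz rule give a double sum over the shares of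
  \<open>k\<close> and \<open>l\<close> that fall on \<open>x\<close>. Exchanging the summations and
  commuting on each factor turns one side into the other.\<close>

lemma schubert_derivation_commute_mult:
  assumes D: "schubert_derivation D"
    and x: "\<And>k l. D k (D l x) = D l (D k x)" and y: "\<And>k l. D k (D l y) = D l (D k y)"
  shows "D k (D l (x * y)) = D l (D k (x * y))"
proof -
  have comp: "D k (D l (x * y)) =
      (\<Sum>a\<le>l. \<Sum>b\<le>k. D b (D a x) * D (k - b) (D (l - a) y))" for k l
    by (simp add: schubert_derivation_mult[OF D] schubert_derivation_sum[OF D])
  have "D k (D l (x * y)) = (\<Sum>b\<le>k. \<Sum>a\<le>l. D b (D a x) * D (k - b) (D (l - a) y))"
    unfolding comp by (rule sum.swap)
  also have "\<dots> = D l (D k (x * y))"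
    unfolding comp by (intro sum.cong refl arg_cong2[where f = "(*)"] x y)
  finally show ?thesis .
qed

lemma schubert_derivation_commute_incl:
  assumes D: "schubert_derivation D"
  shows "D k (D l (exterior_incl v)) = D l (D k (exterior_incl v))"
proof (induction v rule: trunc_induct)
  case (eps i)
  then show ?case
    unfolding eps_def[symmetric] by (simp add: schubert_derivation_eps[OF D] ac_simps)
next
  case (diff x y)
  then show ?case
    by (simp add: exterior_incl_diff schubert_derivation_diff[OF D])
qed

text \<open>Multiples of a vector avoid the value of \<open>D\<close> at \<open>1\<close>, which
  \<^const>\<open>schubert_derivation\<close> prescribes only indirectly.\<close>

lemma schubert_derivation_commute_incl_mult:
  assumes D: "schubert_derivation D"
  shows "D k (D l (exterior_incl v * x)) = D l (D k (exterior_incl v * x))"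
proof -
  define C where "C = {y. \<forall>k l. D k (D l y) = D l (D k y)}"
  have C_mult: "y * z \<in> C" if "y \<in> C" "z \<in> C" for y z
    using schubert_derivation_commute_mult[OF D] that unfolding C_def by blast
  have C_incl: "exterior_incl v \<in> C" for v
    using schubert_derivation_commute_incl[OF D] unfolding C_def by blast
  \<comment> \<open>The induction shows that right multiplication by \<open>x\<close> preserves
    \<open>C\<close>: this is trivial for 1, and associativity handles products.\<close>
  have "\<forall>y\<in>C. y * x \<in> C"
  proof (induction x rule: exterior_induct)
    case one
    then show ?case by simp
  next
    case (incl v)
    then show ?case using C_mult C_incl by blast
  next
    case (diff x z)
    then show ?case
      by (auto simp: C_def right_diff_distrib schubert_derivation_diff[OF D])
  next
    case (mult x z)
    then show ?case by (simp flip: mult.assoc)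
  qed
  then show ?thesis using C_incl unfolding C_def by blast
qed

text \<open>The Leibniz terms after the first begin with \<open>eps (i + 1 + g)\<close>, which is
  \<open>D g (eps (i + 1))\<close>, so they reassemble to a single value of D_(h-1). For h = 0 there
  are none, in accordance with D_(-1) = 0.\<close>

lemma schubert_derivation_eps_mult:
  assumes D: "schubert_derivation D" and i: "i \<ge> 1"
  shows "D h (eps i * q) = eps i * D h q + int_seq D (int h - 1) (eps (i + 1) * q)"
proof (cases h)
  case 0
  then show ?thesis
    using i by (simp add: int_seq_def schubert_derivation_mult[OF D] schubert_derivation_eps[OF D])
next
  case (Suc g)
  then show ?thesis
    using i
    by (simp add: int_seq_def schubert_derivation_mult[OF D] schubert_derivation_eps[OF D]
        sum.atMost_Suc_shift del: sum.atMost_Suc)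
qed

lemma int_seq_add:
  assumes "schubert_derivation D"
  shows "int_seq D k (x + y) = int_seq D k x + int_seq D k y"
  by (simp add: int_seq_def schubert_derivation_add[OF assms])

lemma additive_of_nat_mult:
  fixes f :: "'a::ring_1 \<Rightarrow> 'a"
  assumes "\<And>x y. f (x + y) = f x + f y"
  shows "f (of_nat n * x) = of_nat n * f x"
proof -
  have "f 0 = 0" using assms[of 0 0] by simp
  then show ?thesis by (induction n) (simp_all add: assms distrib_right)
qed

section \<open>Commutation on elements of positive degree\<close>

lemma schubert_derivation_incl:
  assumes D: "schubert_derivation D"
  shows "D k (exterior_incl v) \<in> range exterior_incl"
proof (induction v rule: trunc_induct)
  case (eps i)
  then show ?case
    unfolding eps_def[symmetric] by (simp add: schubert_derivation_eps[OF D]) (simp add: eps_def)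
next
  case (diff x y)
  then obtain a b where "D k (exterior_incl x) = exterior_incl a" "D k (exterior_incl y) = exterior_incl b"
    by blast
  then have "D k (exterior_incl (x - y)) = exterior_incl (a - b)"
    by (simp add: exterior_incl_diff schubert_derivation_diff[OF D])
  then show ?case by (rule range_eqI)
qed

text \<open>The right ideal generated by the vectors, that is, the elements of positive degree. It
  serves as a domain stable under every \<open>D k\<close> on which commutation is
  available.\<close>

inductive_set incl_ideal :: "'a::ab_group_add exterior set" where
  incl_mult: "exterior_incl v * x \<in> incl_ideal"
| add: "x \<in> incl_ideal \<Longrightarrow> y \<in> incl_ideal \<Longrightarrow> x + y \<in> incl_ideal"

text \<open>Each \<open>D k\<close> sends vectors to vectors, so every Leibniz term again starts
  with a vector.\<close>

lemma schubert_derivation_incl_ideal: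
  assumes D: "schubert_derivation D"
  shows "x \<in> incl_ideal \<Longrightarrow> D k x \<in> incl_ideal"
proof (induction rule: incl_ideal.induct)
  case (incl_mult v x)
  have zero: "0 \<in> incl_ideal"
    using incl_ideal.incl_mult[of 0 0] by simp
  have "D a (exterior_incl v) * y \<in> incl_ideal" for a y
    using schubert_derivation_incl[OF D, of a v] incl_ideal.incl_mult by auto
  then have "(\<Sum>a\<in>A. D a (exterior_incl v) * D (k - a) x) \<in> incl_ideal" for A
    by (induction A rule: infinite_finite_induct) (auto intro: zero incl_ideal.add)
  then show ?case by (simp add: schubert_derivation_mult[OF D])
next
  case (add x y)
  then show ?case by (simp add: schubert_derivation_add[OF D] incl_ideal.add)
qed

lemma schubert_derivation_commute:
  assumes D: "schubert_derivation D"
  shows "x \<in> incl_ideal \<Longrightarrow> D k (D l x) = D l (D k x)"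
  by (induction rule: incl_ideal.induct)
    (simp_all add: schubert_derivation_commute_incl_mult[OF D] schubert_derivation_add[OF D])

lemma schubert_derivation_pow_int_seq_commute:
  assumes D: "schubert_derivation D" and x: "x \<in> incl_ideal"
  shows "(D h ^^ m) (int_seq D k x) = int_seq D k ((D h ^^ m) x)"
  using x
proof (induction m arbitrary: x)
  case 0
  then show ?case by simp
next
  case (Suc m)
  \<comment> \<open>The difference 0 - 0 yields \<open>D h 0 = 0\<close>, which settles negative
    \<open>k\<close>, where \<open>int_seq D k\<close> is the zero map.\<close>
  have "D h (int_seq D k x) = int_seq D k (D h x)"
    using schubert_derivation_diff[OF D, of h 0 0] schubert_derivation_commute[OF D Suc.prems]
    by (simp add: int_seq_def)
  then show ?case
    using Suc.IH schubert_derivation_incl_ideal[OF D Suc.prems]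
    by (simp add: funpow_Suc_right del: funpow.simps)
qed

section \<open>Iteration and the binomial formula\<close>

lemma schubert_derivation_pow_add:
  assumes "schubert_derivation D"
  shows "(D h ^^ m) (x + y) = (D h ^^ m) x + (D h ^^ m) y"
  by (induction m) (simp_all add: schubert_derivation_add[OF assms])

text \<open>Pascal's rule under the sum. The first sum on the right is prolonged by the vanishing
  term j = m + 1, so that both sides can be split at j = 0.\<close>

lemma sum_binomial_Suc:
  fixes t :: "nat \<Rightarrow> 'a::semiring_1"
  shows "(\<Sum>j\<le>Suc m. of_nat (Suc m choose j) * t j) =
    (\<Sum>j\<le>m. of_nat (m choose j) * t j) + (\<Sum>j\<le>m. of_nat (m choose j) * t (Suc j))"
proof -
  have "(\<Sum>j\<le>m. of_nat (m choose j) * t j) = (\<Sum>j\<le>Suc m. of_nat (m choose j) * t j)"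
    by (simp add: binomial_eq_0)
  also have "\<dots> = t 0 + (\<Sum>j\<le>m. of_nat (m choose Suc j) * t (Suc j))"
    by (simp add: sum.atMost_Suc_shift del: sum.atMost_Suc)
  finally show ?thesis
    by (simp add: sum.atMost_Suc_shift distrib_right sum.distrib ac_simps del: sum.atMost_Suc)
qed

theorem theorem3p5:
  fixes D :: "nat \<Rightarrow> 'n::finite trunc exterior \<Rightarrow> 'n trunc exterior"
    and h m i :: nat
    and p :: "'n trunc exterior"
  assumes "schubert_derivation D"
    and "i \<ge> 1"
  shows "(D h ^^ m) (eps i * p) =
    (\<Sum>j=0..m. of_nat (m choose j) *
       (int_seq D (int h - 1) ^^ j) (eps (i + j) * (D h ^^ (m - j)) p))"
proof -
  note D = assms(1)
  define F where "F = int_seq D (int h - 1)"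
  have F_add: "F (x + y) = F x + F y" for x y
    unfolding F_def by (rule int_seq_add[OF D])
  have F_sum: "F (\<Sum>j\<le>k. f j) = (\<Sum>j\<le>k. F (f j))" for f and k :: nat
    by (induction k) (simp_all add: F_add)
  have "(D h ^^ m) (eps i * p) =
    (\<Sum>j\<le>m. of_nat (m choose j) * (F ^^ j) (eps (i + j) * (D h ^^ (m - j)) p))"
    using assms(2)
  proof (induction m arbitrary: i p)
    case 0
    then show ?case by simp
  next
    case (Suc m)
    \<comment> \<open>The summands of the claim for \<open>Suc m\<close> without their binomial
      coefficients; both uses of the induction hypothesis are rewritten in terms of them.\<close>
    define t where "t j = (F ^^ j) (eps (i + j) * (D h ^^ (Suc m - j)) p)" for j
    \<comment> \<open>This membership allows the \<open>m\<close> remaining applications of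
      \<open>D h\<close> to move past \<open>F\<close>.\<close>
    have "eps (i + 1) * p \<in> incl_ideal"
      unfolding eps_def by (rule incl_ideal.incl_mult)
    then have "(D h ^^ Suc m) (eps i * p) =
        (D h ^^ m) (eps i * D h p) + F ((D h ^^ m) (eps (i + 1) * p))"
      using Suc.prems
      by (simp add: funpow_Suc_right schubert_derivation_eps_mult[OF D] F_def
          schubert_derivation_pow_add[OF D] schubert_derivation_pow_int_seq_commute[OF D]
          del: funpow.simps)
    also have "(D h ^^ m) (eps i * D h p) = (\<Sum>j\<le>m. of_nat (m choose j) * t j)"
      unfolding Suc.IH[OF Suc.prems]
    proof (rule sum.cong)
      fix j assume "j \<in> {..m}"
      then have "(D h ^^ (m - j)) (D h p) = (D h ^^ (Suc m - j)) p"
        by (simp add: Suc_diff_le funpow_Suc_right del: funpow.simps)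
      then show "of_nat (m choose j) * (F ^^ j) (eps (i + j) * (D h ^^ (m - j)) (D h p)) =
          of_nat (m choose j) * t j"
        by (simp add: t_def)
    qed simp
    \<comment> \<open>The hypothesis at \<open>i + 1\<close> has exponent
      \<open>m - j = Suc m - Suc j\<close> on \<open>D h\<close>, and the outer \<open>F\<close>
      raises the power \<open>j\<close> to \<open>Suc j\<close>.\<close>
    also have "F ((D h ^^ m) (eps (i + 1) * p)) = (\<Sum>j\<le>m. of_nat (m choose j) * t (Suc j))"
      using Suc.IH[of "i + 1" p] by (simp add: F_sum additive_of_nat_mult F_add t_def)
    finally show ?case
      unfolding t_def[symmetric] sum_binomial_Suc .
  qed
  then show ?thesis
    by (simp add: F_def atMost_atLeast0)
qed

end
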